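(* Let $n\ge 1$ be an integer, let $\mathcal{S}\subset\mathbb{R}^n$ be a nonempty closed subset, and let $\bar x\in\mathcal{S}$. If $\mathcal{S}$ is Quasi Prox-Regular at $\bar x$, then the Clarke tangent cone $T^C_{\mathcal{S}}(\bar x)$ to $\mathcal{S}$ at $\bar x$ is a QDQ approximating cone to $\mathcal{S}$ at $\bar x$.
   Context: Notation. $|\cdot|$ is the Euclidean norm; $B_\delta(x)$ is the open ball of center $x$ and radius $\delta$ (in the relevant Euclidean space); for $\mathcal{A}\subseteq\mathbb{R}^n$, $d_{\mathcal A}(x)=\inf\{|x-y|: y\in\mathcal A\}$; for a nonempty closed $\mathcal{A}$, $\Pi_{\mathcal A}(x)=\{y\in\mathcal A: |x-y|=d_{\mathcal A}(x)\}$ (metric projection, a set). $\mathrm{Lin}(\mathbb{R}^N,\mathbb{R}^n)$ is the space of linear maps from $\mathbb{R}^N$ to $\mathbb{R}^n$, with a norm $|\cdot|$. A cone is a set $\mathcal K$ with $\alpha k\in\mathcal K$ for all $\alpha\ge 0$, $k\in \mathcal K$. Clarke tangent cone: $T^C_{\mathcal S}(\bar x)=\{v\in\mathbb{R}^n:\ \limsup_{t\downarrow 0,\,x\to\bar x}\frac{d_{\mathcal S}(x+tv)-d_{\mathcal S}(x)}{t}=0\}$. Proximal normal cone: $N^P_{\mathcal S}(\bar x)=\{\eta\in\mathbb{R}^n:\ \exists r>0 \text{ such that } \bar x\in\Pi_{\mathcal S}(\bar x+r\eta)\}$. $r$-prox-regular set: for $r>0$, a nonempty closed $\mathcal S\subset\mathbb{R}^n$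 is $r$-prox-regular if for each $x\in\mathcal S$, each $\eta\in N^P_{\mathcal S}(x)$ with $|\eta|=1$, and every $s\in(0,r]$, one has $x\in\Pi_{\mathcal S}(x+s\eta)$. Quasi Prox-Regular: a nonempty closed set $\mathcal S\subset\mathbb{R}^n$ is Quasi Prox-Regular at $\bar x\in\mathcal S$ if there exists $\delta>0$ such that either (i) $(\bar x+T^C_{\mathcal S}(\bar x))\cap B_\delta(\bar x)\subseteq\mathcal S$, or (ii) for some $r>0$ there exists an $r$-prox-regular set $\tilde{\mathcal S}$ such that $\mathcal S\cap B_\delta(\bar x)=\tilde{\mathcal S}\cap B_\delta(\bar x)$. Modulus: a monotonically nondecreasing function $\rho:[0,+\infty)\to[0,+\infty)$ with $\lim_{s\to0^+}\rho(s)=\rho(0)=0$. Quasi Differential Quotient (QDQ): let $G:\mathbb{R}^N\rightsquigarrow\mathbb{R}^n$ be a set-valued map, $(\bar\xi,\bar y)\in\mathbb{R}^N\times\mathbb{R}^n$, $\Lambda\subset \mathrm{Lin}(\mathbb{R}^N,\mathbb{R}^n)$ compact, and $\Gamma\subset\mathbb{R}^N$ any subset. $\Lambda$ is a QDQ of $G$ at $(\bar\xi,\bar y)$ in the direction of $\Gamma$ if there exist a modulus $\rho$ and $\bar\delta>0$ such that for any $\delta\in[0,\bar\delta]$ there is a continuous map $(L_\delta,h_\delta):B_\delta(\bar\xi)\cap\Gamma\to \mathrm{Lin}(\mathbb{R}^N,\mathbb{R}^n)\times\mathbb{R}^n$ such that, for all $\xi\in B_\delta(\bar\xi)\cap\Gamma$,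 $\bar y+L_\delta(\xi)\cdot(\xi-\bar\xi)+h_\delta(\xi)\in G(\xi)$, $\min_{L'\in\Lambda}|L_\delta(\xi)-L'|\le\rho(\delta)$, and $|h_\delta(\xi)|\le\delta\rho(\delta)$. QDQ approximating cone: a convex cone $\mathcal K\subset\mathbb{R}^n$ is a QDQ approximating cone to $\mathcal S\subset\mathbb{R}^n$ at $\bar x\in\mathcal S$ if there exist an integer $N\ge0$, a set-valued map $G:\mathbb{R}^N\rightsquigarrow\mathbb{R}^n$, a convex cone $\Gamma\subset\mathbb{R}^N$, and $L\in \mathrm{Lin}(\mathbb{R}^N,\mathbb{R}^n)$ such that $\Lambda=\{L\}$ is a QDQ of $G$ at $(0,\bar x)$ in the direction of $\Gamma$, $G(\Gamma)\subset\mathcal S$ (i.e. $G(\xi)\subset\mathcal S$ for all $\xi\in\Gamma$), and $\mathcal K=L\cdot\Gamma$. *)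

theory Defs
  imports "HOL-Analysis.Analysis"
begin

section \<open>Variational geometry of closed sets\<close>

definition proj_set :: "'a::metric_space set \<Rightarrow> 'a \<Rightarrow> 'a set" where
  "proj_set A x = {y \<in> A. dist x y = infdist x A}"

text \<open>The limsup is taken in the extended reals, and \<open>x\<close> ranges over all points of the space
  near \<open>xbar\<close> (not only those of \<open>S\<close>, and including \<open>xbar\<close> itself).\<close>

definition clarke_tangent_cone :: "'a::real_normed_vector set \<Rightarrow> 'a \<Rightarrow> 'a set" where
  "clarke_tangent_cone S xbar =
     {v. Limsup (at_right (0::real) \<times>\<^sub>F nhds xbar)
           (\<lambda>(t, x). ereal ((infdist (x + t *\<^sub>R v) S - infdist x S) / t)) = 0}"

definition proximal_normal_cone :: "'a::real_normed_vector set \<Rightarrow> 'a \<Rightarrow> 'a set" where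
  "proximal_normal_cone S xbar = {\<eta>. \<exists>r>0. xbar \<in> proj_set S (xbar + r *\<^sub>R \<eta>)}"

definition prox_regular :: "real \<Rightarrow> 'a::real_normed_vector set \<Rightarrow> bool" where
  "prox_regular r S \<longleftrightarrow>
     r > 0 \<and> S \<noteq> {} \<and> closed S \<and>
     (\<forall>x\<in>S. \<forall>\<eta>\<in>proximal_normal_cone S x. norm \<eta> = 1 \<longrightarrow>
        (\<forall>s\<in>{0<..r}. x \<in> proj_set S (x + s *\<^sub>R \<eta>)))"

definition quasi_prox_regular :: "'a::real_normed_vector set \<Rightarrow> 'a \<Rightarrow> bool" where
  "quasi_prox_regular S xbar \<longleftrightarrow>
     S \<noteq> {} \<and> closed S \<and> xbar \<in> S \<and>
     (\<exists>\<delta>>0.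
        (\<lambda>v. xbar + v) ` clarke_tangent_cone S xbar \<inter> ball xbar \<delta> \<subseteq> S \<or>
        (\<exists>r>0. \<exists>S'. prox_regular r S' \<and> S \<inter> ball xbar \<delta> = S' \<inter> ball xbar \<delta>))"


section \<open>The parameter space \<open>\<real>\<^sup>N\<close> and linear maps out of it\<close>

text \<open>The dimension \<open>N\<close> is existentially quantified in the definition of an approximating cone, so
  it cannot be a type. The carrier is that of the library's \<open>Euclidean_space N\<close>: sequences
  \<open>x :: nat \<Rightarrow> real\<close> with \<open>x i = 0\<close> for \<open>i \<ge> N\<close>. Its
  topology is the one of the Euclidean norm \<open>RN_norm N\<close>.\<close>

abbreviation RN :: "nat \<Rightarrow> (nat \<Rightarrow> real) set" where
  "RN N \<equiv> topspace (Euclidean_space N)"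

definition RN_norm :: "nat \<Rightarrow> (nat \<Rightarrow> real) \<Rightarrow> real" where
  "RN_norm N x = L2_set x {..<N}"

definition RN_ball :: "nat \<Rightarrow> (nat \<Rightarrow> real) \<Rightarrow> real \<Rightarrow> (nat \<Rightarrow> real) set" where
  "RN_ball N c \<delta> = {x \<in> RN N. RN_norm N (\<lambda>i. x i - c i) < \<delta>}"

definition RN_convex_cone :: "nat \<Rightarrow> (nat \<Rightarrow> real) set \<Rightarrow> bool" where
  "RN_convex_cone N \<Gamma> \<longleftrightarrow>
     \<Gamma> \<subseteq> RN N \<and>
     (\<forall>x\<in>\<Gamma>. \<forall>c\<ge>0. (\<lambda>i. c * x i) \<in> \<Gamma>) \<and>
     (\<forall>x\<in>\<Gamma>. \<forall>y\<in>\<Gamma>. \<forall>u\<ge>0. \<forall>v\<ge>0. u + v = 1 \<longrightarrow> (\<lambda>i. u * x i + v * y i) \<in> \<Gamma>)"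

text \<open>Extensionality makes equality of elements of \<open>Lin N\<close> the same as equality on \<open>RN N\<close>.\<close>

definition Lin :: "nat \<Rightarrow> ((nat \<Rightarrow> real) \<Rightarrow> 'b::real_normed_vector) set" where
  "Lin N = {L \<in> extensional (RN N).
     (\<forall>x\<in>RN N. \<forall>y\<in>RN N. L (\<lambda>i. x i + y i) = L x + L y) \<and>
     (\<forall>x\<in>RN N. \<forall>c. L (\<lambda>i. c * x i) = c *\<^sub>R L x)}"

text \<open>The operator norm.\<close>

definition Lin_norm :: "nat \<Rightarrow> ((nat \<Rightarrow> real) \<Rightarrow> 'b::real_normed_vector) \<Rightarrow> real" where
  "Lin_norm N L = (SUP x\<in>{x \<in> RN N. RN_norm N x \<le> 1}. norm (L x))"

text \<open>Outside \<open>Lin N\<close> the distance is set to \<open>0\<close>, because the locale \<open>Metric_space\<close> requires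
  nonnegativity and symmetry on the whole type.\<close>

definition Lin_dist ::
    "nat \<Rightarrow> ((nat \<Rightarrow> real) \<Rightarrow> 'b::real_normed_vector) \<Rightarrow> ((nat \<Rightarrow> real) \<Rightarrow> 'b) \<Rightarrow> real" where
  "Lin_dist N L L' =
     (if L \<in> Lin N \<and> L' \<in> Lin N then Lin_norm N (\<lambda>x. L x - L' x) else 0)"

definition Lin_topology :: "nat \<Rightarrow> ((nat \<Rightarrow> real) \<Rightarrow> 'b::real_normed_vector) topology" where
  "Lin_topology N = Metric_space.mtopology (Lin N) (Lin_dist N)"

lemma Lin_add: "\<lbrakk>L \<in> Lin N; x \<in> RN N; y \<in> RN N\<rbrakk> \<Longrightarrow> L (\<lambda>i. x i + y i) = L x + L y"
  and Lin_scale: "\<lbrakk>L \<in> Lin N; x \<in> RN N\<rbrakk> \<Longrightarrow> L (\<lambda>i. c * x i) = c *\<^sub>R L x"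
  by (simp_all add: Lin_def)

lemma Lin_expand:
  assumes L: "L \<in> Lin N" and x: "x \<in> RN N"
  shows "L x = (\<Sum>j<N. x j *\<^sub>R L (\<lambda>i. if i = j then 1 else 0))"
proof -
  have partial: "L (\<lambda>i. if i < k then x i else 0) =
      (\<Sum>j<k. x j *\<^sub>R L (\<lambda>i. if i = j then 1 else 0))" if "k \<le> N" for k
    using that
  proof (induction k)
    case 0
    have "(\<lambda>_. 0) \<in> RN N"
      by (simp add: topspace_Euclidean_space)
    from Lin_scale[OF L this, of 0] show ?case
      by simp
  next
    case (Suc k)
    let ?u = "\<lambda>i. if i < k then x i else 0" and ?e = "\<lambda>i. if i = k then 1 else (0::real)"
    have mem: "?u \<in> RN N" "?e \<in> RN N" "(\<lambda>i. x k * ?e i) \<in> RN N"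
      using Suc.prems by (auto simp: topspace_Euclidean_space)
    have "(\<lambda>i. if i < Suc k then x i else 0) = (\<lambda>i. ?u i + x k * ?e i)"
      by (auto simp: fun_eq_iff less_Suc_eq)
    then have "L (\<lambda>i. if i < Suc k then x i else 0) = L ?u + x k *\<^sub>R L ?e"
      using Lin_add[OF L mem(1) mem(3)] Lin_scale[OF L mem(2), of "x k"] by simp
    then show ?case
      using Suc by simp
  qed
  have "(\<lambda>i. if i < N then x i else 0) = x"
    using x by (auto simp: topspace_Euclidean_space fun_eq_iff)
  with partial[of N] show ?thesis
    by simp
qed

lemma Lin_diff_bdd:
  assumes "L \<in> Lin N" "L' \<in> Lin N"
  shows "bdd_above ((\<lambda>x. norm (L x - L' x)) ` {x \<in> RN N. RN_norm N x \<le> 1})"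
proof -
  let ?e = "\<lambda>j i. if i = j then 1 else (0::real)"
  have bound: "norm (M x) \<le> (\<Sum>j<N. norm (M (?e j)))"
    if M: "M \<in> Lin N" and x: "x \<in> RN N" "RN_norm N x \<le> 1"
    for M :: "(nat \<Rightarrow> real) \<Rightarrow> 'a" and x
  proof -
    have "\<bar>x j\<bar> \<le> 1" if "j < N" for j
      using member_le_L2_set[of "{..<N}" j "\<lambda>i. \<bar>x i\<bar>"] that x(2)
      unfolding RN_norm_def L2_set_def power2_abs by (meson finite_lessThan lessThan_iff order_trans)
    then have "norm (x j *\<^sub>R M (?e j)) \<le> norm (M (?e j))" if "j < N" for j
      using that by (simp add: mult_left_le_one_le)
    then show ?thesis
      unfolding Lin_expand[OF M x(1)] by (intro sum_norm_le) auto
  qed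
  show ?thesis
    using bound[OF assms(1)] bound[OF assms(2)]
    by (intro bdd_aboveI2[where M = "(\<Sum>j<N. norm (L (?e j))) + (\<Sum>j<N. norm (L' (?e j)))"])
      (smt (verit) mem_Collect_eq norm_triangle_ineq4)
qed

lemma Metric_space_Lin:
  "Metric_space (Lin N) (Lin_dist N :: _ \<Rightarrow> ((nat \<Rightarrow> real) \<Rightarrow> 'b::real_normed_vector) \<Rightarrow> real)"
proof
  fix L M K :: "(nat \<Rightarrow> real) \<Rightarrow> 'b"
  let ?B = "{x \<in> RN N. RN_norm N x \<le> 1}"
  have zero_mem: "(\<lambda>_. 0) \<in> ?B"
    by (simp add: topspace_Euclidean_space RN_norm_def L2_set_def)
  have upper: "norm (L x - M x) \<le> Lin_dist N L M"
    if "L \<in> Lin N" "M \<in> Lin N" "x \<in> ?B" for L M :: "(nat \<Rightarrow> real) \<Rightarrow> 'b" and x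
    using cSUP_upper[OF that(3) Lin_diff_bdd[OF that(1,2)]] that
    by (simp add: Lin_dist_def Lin_norm_def)
  show nonneg: "0 \<le> Lin_dist N L M" for L M :: "(nat \<Rightarrow> real) \<Rightarrow> 'b"
  proof (cases "L \<in> Lin N \<and> M \<in> Lin N")
    case True
    then show ?thesis
      using upper[OF _ _ zero_mem, of L M] norm_ge_zero order_trans by blast
  next
    case False
    then show ?thesis
      by (auto simp: Lin_dist_def)
  qed
  show "Lin_dist N L M = Lin_dist N M L"
    by (simp add: Lin_dist_def Lin_norm_def norm_minus_commute conj_commute)
  assume LM: "L \<in> Lin N" "M \<in> Lin N"
  show "Lin_dist N L M = 0 \<longleftrightarrow> L = M"
  proof
    assume "L = M"
    have "?B \<noteq> {}"
      using zero_mem by blast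
    then have "(SUP x\<in>?B. 0::real) = 0"
      by (rule cSUP_const)
    with \<open>L = M\<close> LM show "Lin_dist N L M = 0"
      by (simp add: Lin_dist_def Lin_norm_def)
  next
    assume 0: "Lin_dist N L M = 0"
    have unit: "L (\<lambda>i. if i = j then 1 else 0) = M (\<lambda>i. if i = j then 1 else 0)" if "j < N" for j
    proof -
      have "(\<Sum>i<N. (if i = j then 1 else 0)\<^sup>2) = (1::real)"
        using that by (subst sum.cong[OF refl, of _ _ "\<lambda>i. if i = j then 1 else 0"]) auto
      then have "(\<lambda>i. if i = j then 1 else 0) \<in> ?B"
        using that by (auto simp: topspace_Euclidean_space RN_norm_def L2_set_def)
      from upper[OF LM this] 0 show ?thesis
        by simp
    qed
    have "L x = M x" if "x \<in> RN N" for x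
      using unit by (simp add: Lin_expand[OF LM(1) that] Lin_expand[OF LM(2) that])
    moreover have "L \<in> extensional (RN N)" "M \<in> extensional (RN N)"
      using LM by (simp_all add: Lin_def)
    ultimately show "L = M"
      by (meson extensionalityI)
  qed
  assume K: "K \<in> Lin N"
  have "norm (L x - K x) \<le> Lin_dist N L M + Lin_dist N M K" if "x \<in> ?B" for x
    using upper[OF LM that] upper[OF LM(2) K that] norm_triangle_ineq[of "L x - M x" "M x - K x"]
    by simp
  then have "Lin_norm N (\<lambda>x. L x - K x) \<le> Lin_dist N L M + Lin_dist N M K"
    unfolding Lin_norm_def using zero_mem by (intro cSUP_least) auto
  then show "Lin_dist N L K \<le> Lin_dist N L M + Lin_dist N M K"
    using LM K by (simp add: Lin_dist_def)
qed


section \<open>Quasi differential quotients and approximating cones\<close>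

text \<open>Only the values on \<open>[0, \<infinity>)\<close> matter.\<close>

definition modulus :: "(real \<Rightarrow> real) \<Rightarrow> bool" where
  "modulus \<rho> \<longleftrightarrow>
     (\<forall>s\<ge>0. \<rho> s \<ge> 0) \<and> mono_on {0..} \<rho> \<and> \<rho> 0 = 0 \<and> (\<rho> \<longlongrightarrow> 0) (at_right 0)"

text \<open>The condition \<open>\<exists>L'\<in>\<Lambda>. Lin_dist N (L \<xi>) L' \<le> \<rho> \<delta>\<close> says that the minimum of the distance
  over \<open>\<Lambda>\<close> (attained, as \<open>\<Lambda>\<close> is compact) is at most \<open>\<rho> \<delta>\<close>.
  The open ball is empty for \<open>\<delta> = 0\<close>.\<close>

definition is_QDQ ::
    "nat \<Rightarrow> ((nat \<Rightarrow> real) \<Rightarrow> 'b::real_normed_vector set) \<Rightarrow> (nat \<Rightarrow> real) \<Rightarrow> 'b \<Rightarrow>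
     (nat \<Rightarrow> real) set \<Rightarrow> ((nat \<Rightarrow> real) \<Rightarrow> 'b) set \<Rightarrow> bool" where
  "is_QDQ N G \<xi>bar ybar \<Gamma> \<Lambda> \<longleftrightarrow>
     \<xi>bar \<in> RN N \<and> \<Gamma> \<subseteq> RN N \<and> compactin (Lin_topology N) \<Lambda> \<and>
     (\<exists>\<rho> \<delta>bar. modulus \<rho> \<and> \<delta>bar > 0 \<and>
        (\<forall>\<delta>\<in>{0..\<delta>bar}. \<exists>L h.
           continuous_map (subtopology (Euclidean_space N) (RN_ball N \<xi>bar \<delta> \<inter> \<Gamma>))
             (prod_topology (Lin_topology N) euclidean) (\<lambda>\<xi>. (L \<xi>, h \<xi>)) \<and>
           (\<forall>\<xi>\<in>RN_ball N \<xi>bar \<delta> \<inter> \<Gamma>.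
              ybar + L \<xi> (\<lambda>i. \<xi> i - \<xi>bar i) + h \<xi> \<in> G \<xi> \<and>
              (\<exists>L'\<in>\<Lambda>. Lin_dist N (L \<xi>) L' \<le> \<rho> \<delta>) \<and>
              norm (h \<xi>) \<le> \<delta> * \<rho> \<delta>)))"

definition QDQ_approximating_cone ::
    "'b::real_normed_vector set \<Rightarrow> 'b set \<Rightarrow> 'b \<Rightarrow> bool" where
  "QDQ_approximating_cone K S xbar \<longleftrightarrow>
     cone K \<and> convex K \<and> xbar \<in> S \<and>
     (\<exists>N G \<Gamma> L. RN_convex_cone N \<Gamma> \<and> L \<in> Lin N \<and>
        is_QDQ N G (\<lambda>_. 0) xbar \<Gamma> {L} \<and>
        (\<forall>\<xi>\<in>\<Gamma>. G \<xi> \<subseteq> S) \<and>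
        K = L ` \<Gamma>)"

end

theory Submission
  imports Defs
begin

text \<open>Parametrize a neighbourhood of \<open>xbar\<close> in \<open>S\<close> by tangent vectors. If \<open>K\<close> is a convex cone
  and \<open>p\<close> is a continuous map from a neighbourhood of \<open>0\<close> in \<open>K\<close> into \<open>S\<close> with
  \<open>p v = xbar + v + o(|v|)\<close>, then \<open>K\<close> is a QDQ approximating cone: choose orthonormal coordinates on
  the space, let \<open>L\<close> be the coordinate isometry and \<open>\<Gamma>\<close> the set of coordinate vectors of \<open>K\<close>, take
  the constant map \<open>L\<^sub>\<delta> = L\<close>, and put the whole error \<open>p v - xbar - v\<close> into \<open>h\<^sub>\<delta>\<close>. This is
  \<open>QDQ_approximating_coneI\<close>. It remains to find \<open>p\<close> for \<open>K\<close> the Clarke tangent cone, which is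
  always a closed convex cone.

  If the translated cone lies in \<open>S\<close> near \<open>xbar\<close>, then \<open>p v = xbar + v\<close> has no error at all.
  If \<open>S\<close> coincides near \<open>xbar\<close> with an \<open>r\<close>-prox-regular set \<open>S'\<close>, take for \<open>p v\<close> the metric
  projection of \<open>xbar + v\<close> to \<open>S'\<close>. Two facts make this work. First, the projection to \<open>S'\<close> is
  Lipschitz at distance at most \<open>r / 2\<close> from \<open>S'\<close> (\<open>prox_regular_proj_Lipschitz\<close>), so \<open>p\<close> is
  continuous. Second, the error \<open>|p v - xbar - v|\<close> is the distance of \<open>xbar + v\<close> from \<open>S'\<close>; for
  small \<open>v\<close> it is at most the distance from \<open>S\<close>, which is \<open>o(|v|)\<close> uniformly on the Clarke cone
  (\<open>infdist_clarke_tangent_cone_little_o\<close>).\<close>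


section \<open>The Clarke tangent cone\<close>

text \<open>The upper limit is never negative, because the base points include \<open>xbar\<close> itself, where
  \<open>d\<^sub>S\<close> vanishes and the difference quotient is nonnegative. So only the upper bound on the
  quotient is a condition on \<open>v\<close>.\<close>

lemma clarke_tangent_cone_iff:
  assumes "xbar \<in> S"
  shows "v \<in> clarke_tangent_cone S xbar \<longleftrightarrow>
    (\<forall>e>0. \<exists>d>0. \<forall>t x. 0 < t \<longrightarrow> t < d \<longrightarrow> dist x xbar < d \<longrightarrow>
       infdist (x + t *\<^sub>R v) S \<le> infdist x S + e * t)"
proof -
  let ?F = "at_right (0::real) \<times>\<^sub>F nhds xbar"
  let ?q = "\<lambda>t x. (infdist (x + t *\<^sub>R v) S - infdist x S) / t"
  have nonneg: "0 \<le> Limsup ?F (\<lambda>(t, x). ereal (?q t x))"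
    unfolding Limsup_def
  proof (rule INF_greatest)
    fix P assume "P \<in> {P. eventually P ?F}"
    then obtain Pf Pg where "eventually Pf (at_right 0)" "eventually Pg (nhds xbar)"
      and P: "\<And>t x. Pf t \<Longrightarrow> Pg x \<Longrightarrow> P (t, x)"
      by (auto simp: eventually_prod_filter)
    then obtain t :: real where "0 < t" "P (t, xbar)"
      by (metis eventually_at_right_field eventually_nhds_x_imp_x field_lbound_gt_zero zero_less_one dense)
    moreover have "0 \<le> ereal (?q t xbar)"
      using \<open>0 < t\<close> assms by (simp add: infdist_nonneg)
    ultimately show "0 \<le> (SUP z\<in>Collect P. case z of (t, x) \<Rightarrow> ereal (?q t x))"
      by (intro SUP_upper2[of "(t, xbar)"]) auto
  qed
  have "v \<in> clarke_tangent_cone S xbar \<longleftrightarrow> Limsup ?F (\<lambda>(t, x). ereal (?q t x)) \<le> 0"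
    using nonneg by (auto simp: clarke_tangent_cone_def)
  also have "\<dots> \<longleftrightarrow> (\<forall>e>0. \<forall>\<^sub>F (t, x) in ?F. ?q t x < e)"
    unfolding Limsup_le_iff
  proof (intro iffI allI impI)
    fix e :: real assume "\<forall>y>0. \<forall>\<^sub>F z in ?F. (case z of (t, x) \<Rightarrow> ereal (?q t x)) < y" "e > 0"
    then have "\<forall>\<^sub>F z in ?F. (case z of (t, x) \<Rightarrow> ereal (?q t x)) < ereal e"
      by auto
    then show "\<forall>\<^sub>F (t, x) in ?F. ?q t x < e"
      by (rule eventually_mono) auto
  next
    fix y :: ereal assume *: "\<forall>e>0. \<forall>\<^sub>F (t, x) in ?F. ?q t x < e" "y > 0"
    obtain e where e: "0 < e" "ereal e \<le> y"
      using \<open>y > 0\<close> by (cases y) (auto intro: that[of 1])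
    have "\<forall>\<^sub>F (t, x) in ?F. ?q t x < e"
      using * e by blast
    then show "\<forall>\<^sub>F z in ?F. (case z of (t, x) \<Rightarrow> ereal (?q t x)) < y"
      by (rule eventually_mono) (auto intro: order.strict_trans2[OF _ e(2)])
  qed
  also have "\<dots> \<longleftrightarrow> (\<forall>e>0. \<exists>d>0. \<forall>t x. 0 < t \<longrightarrow> t < d \<longrightarrow> dist x xbar < d \<longrightarrow> ?q t x \<le> e)"
  proof (intro iffI allI impI)
    fix e :: real assume *: "\<forall>e>0. \<forall>\<^sub>F (t, x) in ?F. ?q t x < e" "e > 0"
    then obtain Pf Pg where P: "eventually Pf (at_right 0)" "eventually Pg (nhds xbar)"
      "\<And>t x. Pf t \<Longrightarrow> Pg x \<Longrightarrow> ?q t x < e"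
      by (fastforce simp: eventually_prod_filter)
    obtain a where a: "a > 0" "\<And>t. 0 < t \<Longrightarrow> t < a \<Longrightarrow> Pf t"
      using P(1) by (auto simp: eventually_at_right_field)
    obtain b where b: "b > 0" "\<And>x. dist x xbar < b \<Longrightarrow> Pg x"
      using P(2) by (auto simp: eventually_nhds_metric)
    show "\<exists>d>0. \<forall>t x. 0 < t \<longrightarrow> t < d \<longrightarrow> dist x xbar < d \<longrightarrow> ?q t x \<le> e"
      using a b P(3) by (intro exI[of _ "min a b"]) (auto intro: less_imp_le)
  next
    fix e :: real assume *: "\<forall>e>0. \<exists>d>0. \<forall>t x. 0 < t \<longrightarrow> t < d \<longrightarrow> dist x xbar < d \<longrightarrow> ?q t x \<le> e"
      "e > 0"
    then obtain d where d: "d > 0" "\<And>t x. 0 < t \<Longrightarrow> t < d \<Longrightarrow> dist x xbar < d \<Longrightarrow> ?q t x \<le> e / 2"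
      by (meson half_gt_zero)
    have "\<forall>\<^sub>F t in at_right 0. 0 < t \<and> t < d"
      using d(1) by (auto simp: eventually_at_right_field)
    moreover have "\<forall>\<^sub>F x in nhds xbar. dist x xbar < d"
      using d(1) by (auto simp: eventually_nhds_metric)
    moreover have "?q t x < e" if "0 < t \<and> t < d" "dist x xbar < d" for t x
      using d(2)[of t x] that \<open>e > 0\<close> by linarith
    ultimately show "\<forall>\<^sub>F (t, x) in ?F. ?q t x < e"
      unfolding eventually_prod_filter case_prod_conv by blast
  qed
  also have "\<dots> \<longleftrightarrow> (\<forall>e>0. \<exists>d>0. \<forall>t x. 0 < t \<longrightarrow> t < d \<longrightarrow> dist x xbar < d \<longrightarrow>
       infdist (x + t *\<^sub>R v) S \<le> infdist x S + e * t)"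
    by (simp add: pos_divide_le_eq diff_le_eq add.commute cong: imp_cong)
  finally show ?thesis .
qed

lemma clarke_tangent_cone_zero:
  assumes "xbar \<in> S"
  shows "0 \<in> clarke_tangent_cone S xbar"
  unfolding clarke_tangent_cone_iff[OF assms] by (intro allI impI exI[of _ 1] conjI) auto

lemma clarke_tangent_cone_scaleR:
  assumes "xbar \<in> S" "v \<in> clarke_tangent_cone S xbar" "0 \<le> c"
  shows "c *\<^sub>R v \<in> clarke_tangent_cone S xbar"
proof (cases "c = 0")
  case True
  then show ?thesis
    using clarke_tangent_cone_zero[OF assms(1)] by simp
next
  case False
  with assms have c: "c > 0"
    by simp
  show ?thesis
    unfolding clarke_tangent_cone_iff[OF assms(1)]
  proof (intro allI impI)
    fix e :: real assume "e > 0"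
    with c have "e / c > 0"
      by simp
    with assms(2) obtain d where d: "d > 0"
      "\<And>t x. 0 < t \<Longrightarrow> t < d \<Longrightarrow> dist x xbar < d \<Longrightarrow>
         infdist (x + t *\<^sub>R v) S \<le> infdist x S + (e / c) * t"
      unfolding clarke_tangent_cone_iff[OF assms(1)] by blast
    have "infdist (x + t *\<^sub>R c *\<^sub>R v) S \<le> infdist x S + e * t"
      if "0 < t" "t < min d (d / c)" "dist x xbar < min d (d / c)" for t x
      using d(2)[of "t * c" x] that c by (simp add: field_simps)
    then show "\<exists>d>0. \<forall>t x. 0 < t \<longrightarrow> t < d \<longrightarrow> dist x xbar < d \<longrightarrow>
        infdist (x + t *\<^sub>R c *\<^sub>R v) S \<le> infdist x S + e * t"
      using d(1) c by (intro exI[of _ "min d (d / c)"]) auto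
  qed
qed

text \<open>Because the base point \<open>x\<close> in the definition moves freely near \<open>xbar\<close>, the bound for \<open>w\<close>
  may be used at the point \<open>x + t v\<close> already reached by a step along \<open>v\<close>. The contingent cone,
  whose base point is fixed, has no such property.\<close>

lemma clarke_tangent_cone_add:
  assumes "xbar \<in> S" "v \<in> clarke_tangent_cone S xbar" "w \<in> clarke_tangent_cone S xbar"
  shows "v + w \<in> clarke_tangent_cone S xbar"
  unfolding clarke_tangent_cone_iff[OF assms(1)]
proof (intro allI impI)
  fix e :: real assume "e > 0"
  then have e2: "e / 2 > 0"
    by simp
  obtain a where a: "a > 0" "\<And>t x. 0 < t \<Longrightarrow> t < a \<Longrightarrow> dist x xbar < a \<Longrightarrow>
      infdist (x + t *\<^sub>R v) S \<le> infdist x S + (e / 2) * t"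
    using assms(2) e2 unfolding clarke_tangent_cone_iff[OF assms(1)] by blast
  obtain b where b: "b > 0" "\<And>t x. 0 < t \<Longrightarrow> t < b \<Longrightarrow> dist x xbar < b \<Longrightarrow>
      infdist (x + t *\<^sub>R w) S \<le> infdist x S + (e / 2) * t"
    using assms(3) e2 unfolding clarke_tangent_cone_iff[OF assms(1)] by blast
  \<comment> \<open>The factor \<open>2 (1 + |v|)\<close> keeps the shifted base point \<open>x + t v\<close> within \<open>b\<close> of \<open>xbar\<close>.\<close>
  let ?d = "min a (b / (2 * (1 + norm v)))"
  have pos: "1 + norm v > 0"
    by (simp add: add_pos_nonneg)
  have "infdist (x + t *\<^sub>R (v + w)) S \<le> infdist x S + e * t"
    if t: "0 < t" "t < ?d" and x: "dist x xbar < ?d" for t x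
  proof -
    have t': "t + t * norm v < b / 2" and x': "dist x xbar + dist x xbar * norm v < b / 2"
      using t x pos by (simp_all add: field_simps)
    have "0 \<le> t * norm v" "0 \<le> dist x xbar * norm v"
      using t by simp_all
    moreover have "dist (x + t *\<^sub>R v) xbar \<le> dist x xbar + t * norm v"
      using norm_triangle_ineq[of "x - xbar" "t *\<^sub>R v"] t by (simp add: dist_norm algebra_simps)
    ultimately have "t < b" "dist (x + t *\<^sub>R v) xbar < b"
      using t x' t' \<open>b > 0\<close> by linarith+
    from b(2)[OF t(1) this] a(2)[of t x] t x show ?thesis
      by (simp add: algebra_simps)
  qed
  then show "\<exists>d>0. \<forall>t x. 0 < t \<longrightarrow> t < d \<longrightarrow> dist x xbar < d \<longrightarrow>
      infdist (x + t *\<^sub>R (v + w)) S \<le> infdist x S + e * t"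
    using a(1) b(1) pos by (intro exI[of _ ?d]) auto
qed

lemma convex_cone_clarke_tangent_cone:
  assumes "xbar \<in> S"
  shows "convex (clarke_tangent_cone S xbar)" "cone (clarke_tangent_cone S xbar)"
  using clarke_tangent_cone_add[OF assms] clarke_tangent_cone_scaleR[OF assms]
    convex_cone[of "clarke_tangent_cone S xbar"] by blast+

lemma infdist_le_infdist_plus_norm:
  "infdist (x + y) S \<le> infdist (x + z) S + norm (y - z)"
  using infdist_triangle[of "x + y" S "x + z"] by (simp add: dist_norm)

lemma closed_clarke_tangent_cone:
  assumes "xbar \<in> S"
  shows "closed (clarke_tangent_cone S xbar)"
proof -
  have "v \<in> clarke_tangent_cone S xbar" if v: "v \<in> closure (clarke_tangent_cone S xbar)" for v
    unfolding clarke_tangent_cone_iff[OF assms]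
  proof (intro allI impI)
    fix e :: real assume "e > 0"
    then have e2: "e / 2 > 0"
      by simp
    then obtain w where w: "w \<in> clarke_tangent_cone S xbar" "norm (v - w) \<le> e / 2"
      using v unfolding closure_approachable dist_norm by (metis norm_minus_commute less_imp_le)
    with e2 obtain d where d: "d > 0"
      "\<And>t x. 0 < t \<Longrightarrow> t < d \<Longrightarrow> dist x xbar < d \<Longrightarrow>
         infdist (x + t *\<^sub>R w) S \<le> infdist x S + (e / 2) * t"
      unfolding clarke_tangent_cone_iff[OF assms] by blast
    have "infdist (x + t *\<^sub>R v) S \<le> infdist x S + e * t"
      if "0 < t" "t < d" "dist x xbar < d" for t x
    proof -
      have "norm (t *\<^sub>R v - t *\<^sub>R w) \<le> t * (e / 2)"
        using w(2) that(1) by (simp flip: scaleR_diff_right)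
      with d(2)[OF that] infdist_le_infdist_plus_norm[of x "t *\<^sub>R v" S "t *\<^sub>R w"] show ?thesis
        by (simp add: field_simps)
    qed
    then show "\<exists>d>0. \<forall>t x. 0 < t \<longrightarrow> t < d \<longrightarrow> dist x xbar < d \<longrightarrow>
        infdist (x + t *\<^sub>R v) S \<le> infdist x S + e * t"
      using d(1) by blast
  qed
  then show ?thesis
    by (metis closure_subset_eq subsetI)
qed

text \<open>The definition of the cone gives \<open>d\<^sub>S(xbar + t v) = o(t)\<close> separately for each \<open>v\<close>; the
  rate is uniform over unit vectors \<open>v\<close> of the cone, since they form a compact set and \<open>d\<^sub>S\<close> is
  1-Lipschitz.\<close>

lemma infdist_clarke_tangent_cone_little_o:
  fixes S :: "'a::euclidean_space set"
  assumes "xbar \<in> S" "e > 0"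
  shows "\<exists>d>0. \<forall>v\<in>clarke_tangent_cone S xbar. norm v < d \<longrightarrow> infdist (xbar + v) S \<le> e * norm v"
proof -
  let ?T = "clarke_tangent_cone S xbar"
  have e2: "e / 2 > 0"
    using assms by simp
  have "compact (?T \<inter> sphere 0 1)"
    using closed_clarke_tangent_cone[OF assms(1)] by (simp add: closed_Int_compact)
  then obtain k where k: "finite k" "k \<subseteq> ?T \<inter> sphere 0 1" "?T \<inter> sphere 0 1 \<subseteq> (\<Union>w\<in>k. ball w (e / 2))"
    using compactE_image[of "?T \<inter> sphere 0 1" "?T \<inter> sphere 0 1" "\<lambda>w. ball w (e / 2)"] e2
    by (metis (no_types, lifting) UN_iff centre_in_ball open_ball subsetI)
  have "\<exists>d>0. \<forall>t. 0 < t \<longrightarrow> t < d \<longrightarrow> infdist (xbar + t *\<^sub>R w) S \<le> (e / 2) * t" if "w \<in> k" for w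
  proof -
    have "w \<in> ?T"
      using k that by blast
    with e2 obtain d where "d > 0" "\<And>t x. 0 < t \<Longrightarrow> t < d \<Longrightarrow> dist x xbar < d \<Longrightarrow>
         infdist (x + t *\<^sub>R w) S \<le> infdist x S + (e / 2) * t"
      unfolding clarke_tangent_cone_iff[OF assms(1)] by blast
    from this(1) this(2)[of _ xbar] show ?thesis
      using assms(1) by auto
  qed
  then obtain d where d: "\<And>w. w \<in> k \<Longrightarrow> d w > 0"
    "\<And>w t. w \<in> k \<Longrightarrow> 0 < t \<Longrightarrow> t < d w \<Longrightarrow> infdist (xbar + t *\<^sub>R w) S \<le> (e / 2) * t"
    by metis
  define D where "D = Min (insert 1 (d ` k))"
  have D: "D > 0" "\<And>w. w \<in> k \<Longrightarrow> D \<le> d w"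
    using k(1) d(1) by (auto simp: D_def)
  have "infdist (xbar + v) S \<le> e * norm v" if v: "v \<in> ?T" "norm v < D" for v
  proof (cases "v = 0")
    case True
    then show ?thesis
      using assms by simp
  next
    case False
    let ?u = "(1 / norm v) *\<^sub>R v"
    have "?u \<in> ?T \<inter> sphere 0 1"
      using clarke_tangent_cone_scaleR[OF assms(1) v(1), of "1 / norm v"] False by simp
    then obtain w where w: "w \<in> k" "norm (w - ?u) < e / 2"
      using k(3) by (auto simp: dist_norm)
    have "v - norm v *\<^sub>R w = norm v *\<^sub>R (?u - w)"
      using False by (simp add: scaleR_diff_right)
    then have "norm (v - norm v *\<^sub>R w) \<le> norm v * (e / 2)"
      using w(2) mult_left_mono[of "norm (?u - w)" "e / 2" "norm v"]
      by (simp only: norm_scaleR norm_minus_commute abs_norm_cancel) simp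
    moreover have "infdist (xbar + norm v *\<^sub>R w) S \<le> (e / 2) * norm v"
      using d(2)[OF w(1)] D(2)[OF w(1)] v(2) False by simp
    ultimately show ?thesis
      using infdist_le_infdist_plus_norm[of xbar v S "norm v *\<^sub>R w"] by (simp add: field_simps)
  qed
  with D(1) show ?thesis
    by blast
qed


section \<open>Metric projection onto a prox-regular set\<close>

text \<open>The open ball of radius \<open>r\<close> touching \<open>S\<close> at \<open>x\<close> in the normal direction \<open>u - x\<close> contains
  no point \<open>y\<close> of \<open>S\<close>; expanding the square of the distance from \<open>y\<close> to its centre gives the bound.\<close>

lemma prox_regular_normal_inequality:
  fixes S :: "'a::real_inner set"
  assumes S: "prox_regular r S" and x: "x \<in> proj_set S u" and y: "y \<in> S"
  shows "(u - x) \<bullet> (y - x) \<le> norm (u - x) / (2 * r) * (norm (y - x))\<^sup>2"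
proof (cases "u = x")
  case True
  then show ?thesis
    by simp
next
  case False
  define m where "m = norm (u - x)"
  define \<eta> where "\<eta> = (1 / m) *\<^sub>R (u - x)"
  have m: "m > 0" and \<eta>: "norm \<eta> = 1" "m *\<^sub>R \<eta> = u - x"
    using False by (simp_all add: m_def \<eta>_def)
  have r: "r > 0"
    using S by (simp add: prox_regular_def)
  have "x \<in> proj_set S (x + m *\<^sub>R \<eta>)"
    using x \<eta>(2) by simp
  with m have "\<eta> \<in> proximal_normal_cone S x"
    unfolding proximal_normal_cone_def by blast
  moreover have "x \<in> S"
    using x by (simp add: proj_set_def)
  ultimately have "x \<in> proj_set S (x + r *\<^sub>R \<eta>)"
    using S \<eta>(1) unfolding prox_regular_def by auto
  then have "dist (x + r *\<^sub>R \<eta>) x \<le> dist (x + r *\<^sub>R \<eta>) y"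
    using infdist_le[OF y] by (simp add: proj_set_def)
  then have "r \<le> norm (r *\<^sub>R \<eta> - (y - x))"
    using r \<eta>(1) by (simp add: dist_norm algebra_simps)
  then have "r\<^sup>2 \<le> (norm (r *\<^sub>R \<eta> - (y - x)))\<^sup>2"
    using r by (intro power_mono) auto
  also have "\<dots> = (norm (r *\<^sub>R \<eta>))\<^sup>2 - 2 * ((r *\<^sub>R \<eta>) \<bullet> (y - x)) + (norm (y - x))\<^sup>2"
    unfolding power2_norm_eq_inner inner_diff_left[of "r *\<^sub>R \<eta>"] inner_diff_right[of _ "r *\<^sub>R \<eta>"]
      inner_commute[of "y - x" "r *\<^sub>R \<eta>"] by simp
  also have "\<dots> = r\<^sup>2 - 2 * r * (\<eta> \<bullet> (y - x)) + (norm (y - x))\<^sup>2"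
    using \<eta>(1) by simp
  finally have "\<eta> \<bullet> (y - x) \<le> (norm (y - x))\<^sup>2 / (2 * r)"
    using r by (simp add: field_simps)
  then have "m * (\<eta> \<bullet> (y - x)) \<le> m * ((norm (y - x))\<^sup>2 / (2 * r))"
    using m by (intro mult_left_mono) auto
  moreover have "m * (\<eta> \<bullet> (y - x)) = (u - x) \<bullet> (y - x)"
    using \<eta>(2) by (metis inner_scaleR_left)
  ultimately show ?thesis
    by (simp add: m_def)
qed

text \<open>The normal inequality at \<open>p\<close> tested with \<open>q\<close> and the one at \<open>q\<close> tested with \<open>p\<close> add up to
  a lower bound on the inner product of \<open>(u - p) - (w - q)\<close> with \<open>p - q\<close>, which would be \<open>0\<close>
  for a convex set; at distance at most \<open>r / 2\<close> from the set the bound is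
  \<open>- |p - q|\<^sup>2 / 2\<close>, which leaves the Lipschitz constant 2.\<close>

lemma prox_regular_proj_Lipschitz:
  fixes S :: "'a::real_inner set"
  assumes S: "prox_regular r S" and p: "p \<in> proj_set S u" and q: "q \<in> proj_set S w"
    and u: "norm (u - p) \<le> r / 2" and w: "norm (w - q) \<le> r / 2"
  shows "norm (p - q) \<le> 2 * norm (u - w)"
proof -
  have r: "r > 0"
    using S by (simp add: prox_regular_def)
  have quarter: "c / (2 * r) * (norm (p - q))\<^sup>2 \<le> (norm (p - q))\<^sup>2 / 4" if "c \<le> r / 2" for c
  proof -
    have "c / (2 * r) \<le> 1 / 4"
      using that r by (simp add: field_simps)
    then have "c / (2 * r) * (norm (p - q))\<^sup>2 \<le> 1 / 4 * (norm (p - q))\<^sup>2"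
      by (rule mult_right_mono) simp
    then show ?thesis
      by simp
  qed
  have mem: "p \<in> S" "q \<in> S"
    using p q by (simp_all add: proj_set_def)
  have "(u - p) \<bullet> (q - p) \<le> (norm (p - q))\<^sup>2 / 4"
    using prox_regular_normal_inequality[OF S p mem(2)] quarter[OF u] by (simp add: norm_minus_commute)
  moreover have "(w - q) \<bullet> (p - q) \<le> (norm (p - q))\<^sup>2 / 4"
    using prox_regular_normal_inequality[OF S q mem(1)] quarter[OF w] by simp
  moreover have "(u - p) \<bullet> (q - p) + (w - q) \<bullet> (p - q) = (norm (p - q))\<^sup>2 - (u - w) \<bullet> (p - q)"
    by (simp add: power2_norm_eq_inner algebra_simps inner_commute)
  ultimately have "(norm (p - q))\<^sup>2 / 2 \<le> (u - w) \<bullet> (p - q)"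
    by linarith
  also have "\<dots> \<le> norm (u - w) * norm (p - q)"
    by (rule norm_cauchy_schwarz)
  finally show ?thesis
    by (cases "p = q") (auto simp: power2_eq_square)
qed

lemma prox_regular_continuous_projection:
  fixes S :: "'a::euclidean_space set"
  assumes S: "prox_regular r S"
  obtains P where "\<And>u. P u \<in> S" "\<And>u. dist u (P u) = infdist u S"
    "continuous_on {u. infdist u S \<le> r / 2} P"
proof -
  have "closed S" "S \<noteq> {}"
    using S by (simp_all add: prox_regular_def)
  then have "\<exists>y. y \<in> proj_set S u" for u
    using infdist_attains_inf[of S u] unfolding proj_set_def by (metis (mono_tags, lifting) mem_Collect_eq)
  then obtain P where P: "\<And>u. P u \<in> proj_set S u"
    by metis
  then have mem: "P u \<in> S" "dist u (P u) = infdist u S" for u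
    by (simp_all add: proj_set_def)
  have "2-lipschitz_on {u. infdist u S \<le> r / 2} P"
    using prox_regular_proj_Lipschitz[OF S P P] mem(2)
    by (intro lipschitz_onI) (simp_all add: dist_norm)
  then show ?thesis
    using that[OF mem] lipschitz_on_continuous_on by blast
qed


section \<open>Approximating cones from tangent parametrizations\<close>

text \<open>The modulus is the running supremum of the quotients \<open>f v / |v|\<close> over \<open>|v| \<le> s\<close>. Restricting
  to \<open>|v| < d\<close>, where the quotients are at most 1, makes the supremum finite for every \<open>s\<close>, and
  the extra element \<open>0\<close> makes it nonnegative when \<open>K\<close> has no small vectors or \<open>f\<close> is negative.\<close>

lemma modulus_of_little_o:
  fixes f :: "'a::real_normed_vector \<Rightarrow> real"
  assumes "\<And>e. e > 0 \<Longrightarrow> \<exists>d>0. \<forall>v\<in>K. norm v < d \<longrightarrow> f v \<le> e * norm v"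
  obtains \<rho> d where "modulus \<rho>" "d > 0" "\<And>v. v \<in> K \<Longrightarrow> norm v < d \<Longrightarrow> f v \<le> norm v * \<rho> (norm v)"
proof -
  obtain d where d: "d > 0" "\<And>v. v \<in> K \<Longrightarrow> norm v < d \<Longrightarrow> f v \<le> norm v"
    using assms[of 1] by auto
  define Q where "Q s = insert 0 {f v / norm v | v. v \<in> K \<and> norm v < d \<and> norm v \<le> s}" for s
  define \<rho> where "\<rho> s = Sup (Q s)" for s
  have le1: "x \<le> 1" if "x \<in> Q s" for x s
  proof -
    have "f v / norm v \<le> 1" if "v \<in> K" "norm v < d" for v
      using d(2)[OF that] by (cases "v = 0") (auto simp: pos_divide_le_eq)
    then show ?thesis
      using \<open>x \<in> Q s\<close> by (auto simp: Q_def)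
  qed
  have bdd: "bdd_above (Q s)" for s
    using le1 by (rule bdd_aboveI)
  have ne: "Q s \<noteq> {}" for s
    by (simp add: Q_def)
  have nonneg: "0 \<le> \<rho> s" for s
    unfolding \<rho>_def by (intro cSup_upper bdd) (simp add: Q_def)
  have "mono_on {0..} \<rho>"
    unfolding \<rho>_def by (intro mono_onI cSup_subset_mono bdd ne) (auto simp: Q_def)
  moreover have "\<rho> 0 = 0"
  proof -
    have "Q 0 = {0}"
      by (auto simp: Q_def)
    then show ?thesis
      by (simp add: \<rho>_def)
  qed
  moreover have "(\<rho> \<longlongrightarrow> 0) (at_right 0)"
    unfolding tendsto_iff
  proof (intro allI impI)
    fix e :: real assume "e > 0"
    then obtain a where a: "a > 0" "\<And>v. v \<in> K \<Longrightarrow> norm v < a \<Longrightarrow> f v \<le> (e / 2) * norm v"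
      using assms[of "e / 2"] by auto
    have "\<rho> s \<le> e / 2" if "0 < s" "s < a" for s
    proof -
      have "f v / norm v \<le> e / 2" if "v \<in> K" "norm v \<le> s" for v
        using a(2)[OF that(1)] that(2) \<open>s < a\<close> \<open>e > 0\<close>
        by (cases "v = 0") (auto simp: pos_divide_le_eq)
      then show ?thesis
        unfolding \<rho>_def using \<open>e > 0\<close> by (intro cSup_least ne) (auto simp: Q_def)
    qed
    then have "dist (\<rho> s) 0 < e" if "0 < s" "s < a" for s
      using that nonneg[of s] \<open>e > 0\<close> by fastforce
    then show "\<forall>\<^sub>F s in at_right 0. dist (\<rho> s) 0 < e"
      using a(1) by (auto simp: eventually_at_right_field)
  qed
  ultimately have "modulus \<rho>"
    using nonneg by (simp add: modulus_def)
  moreover have "f v \<le> norm v * \<rho> (norm v)" if "v \<in> K" "norm v < d" for v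
  proof (cases "v = 0")
    case True
    then show ?thesis
      using d(2)[OF that] by simp
  next
    case False
    have "f v / norm v \<le> \<rho> (norm v)"
      unfolding \<rho>_def using that by (intro cSup_upper bdd) (auto simp: Q_def)
    with False show ?thesis
      by (simp add: pos_divide_le_eq mult.commute)
  qed
  ultimately show ?thesis
    using that d(1) by blast
qed

lemma subtopology_Euclidean_space_eq_top_of_set:
  assumes "A \<subseteq> RN N"
  shows "subtopology (Euclidean_space N) A = top_of_set A"
proof -
  have "Euclidean_space N = top_of_set (RN N)"
    by (simp add: Euclidean_space_def topspace_Euclidean_space euclidean_product_topology)
  then show ?thesis
    using assms by (metis subtopology_subtopology inf.absorb2)
qed

lemma Euclidean_coordinates:
  obtains J :: "(nat \<Rightarrow> real) \<Rightarrow> 'a::euclidean_space"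
  where "J ` RN DIM('a) = UNIV" "\<And>x. x \<in> RN DIM('a) \<Longrightarrow> norm (J x) = RN_norm DIM('a) x"
    "\<And>x y. J (\<lambda>i. x i + y i) = J x + J y" "\<And>c x. J (\<lambda>i. c * x i) = c *\<^sub>R J x"
    "continuous_on UNIV J"
proof -
  obtain b where b: "bij_betw b {..<DIM('a)} (Basis :: 'a set)"
    using finite_same_card_bij[of "{..<DIM('a)}" "Basis :: 'a set"] by auto
  define J where "J x = (\<Sum>i<DIM('a). x i *\<^sub>R b i)" for x :: "nat \<Rightarrow> real"
  have inner: "J x \<bullet> b i = x i" if "i < DIM('a)" for x i
  proof -
    have "b j \<bullet> b i = (if j = i then 1 else 0)" if "j < DIM('a)" for j
    proof -
      have "b j \<in> Basis" "b i \<in> Basis" "b j = b i \<longleftrightarrow> j = i"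
        using b that \<open>i < DIM('a)\<close> by (auto simp: bij_betw_def inj_on_eq_iff)
      then show ?thesis
        by (simp add: inner_Basis)
    qed
    then have "J x \<bullet> b i = (\<Sum>j<DIM('a). if j = i then x i else 0)"
      unfolding J_def inner_sum_left by (intro sum.cong) auto
    with that show ?thesis
      by simp
  qed
  have "J ` RN DIM('a) = UNIV"
  proof (intro subset_antisym subset_UNIV subsetI)
    fix v :: 'a
    let ?x = "\<lambda>i. if i < DIM('a) then v \<bullet> b i else 0"
    have "?x \<in> RN DIM('a)"
      by (simp add: topspace_Euclidean_space)
    have "J ?x = (\<Sum>i<DIM('a). (v \<bullet> b i) *\<^sub>R b i)"
      unfolding J_def by (intro sum.cong) auto
    also have "\<dots> = (\<Sum>b\<in>Basis. (v \<bullet> b) *\<^sub>R b)"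
      by (rule sum.reindex_bij_betw[OF b])
    finally have "v = J ?x"
      by (simp add: euclidean_representation)
    with \<open>?x \<in> RN DIM('a)\<close> show "v \<in> J ` RN DIM('a)"
      by blast
  qed
  moreover have "norm (J x) = RN_norm DIM('a) x" if "x \<in> RN DIM('a)" for x
  proof -
    have "J x \<bullet> J x = (\<Sum>c\<in>Basis. (J x \<bullet> c)\<^sup>2)"
      by (simp add: euclidean_inner[of "J x" "J x"] power2_eq_square)
    also have "\<dots> = (\<Sum>i<DIM('a). (J x \<bullet> b i)\<^sup>2)"
      by (rule sum.reindex_bij_betw[OF b, symmetric])
    also have "\<dots> = (\<Sum>i<DIM('a). (x i)\<^sup>2)"
      by (intro sum.cong) (simp_all add: inner)
    finally show ?thesis
      by (simp add: norm_eq_sqrt_inner RN_norm_def L2_set_def)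
  qed
  moreover have "J (\<lambda>i. x i + y i) = J x + J y" "J (\<lambda>i. c * x i) = c *\<^sub>R J x" for x y c
    by (simp_all add: J_def scaleR_left_distrib sum.distrib scaleR_sum_right)
  moreover have "continuous_on UNIV J"
    unfolding J_def
    by (intro continuous_intros continuous_on_product_coordinates)
  ultimately show ?thesis
    by (rule that)
qed

text \<open>A map into \<open>S\<close> whose derivative at \<open>0\<close> along \<open>K\<close> is the identity exhibits \<open>K\<close> as a first
  order approximation of \<open>S\<close>. The set-valued map \<open>G\<close> is constantly \<open>S\<close>, so that the inclusion
  required of a quasi differential quotient says exactly that \<open>p\<close> takes values in \<open>S\<close>, and a
  single \<open>h\<close> serves for all \<open>\<delta>\<close>.\<close>

lemma QDQ_approximating_coneI:
  fixes S K :: "'a::euclidean_space set"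
  assumes K: "convex K" "cone K"
    and p: "continuous_on (K \<inter> ball 0 d) p" "d > 0"
    and mem: "\<And>v. v \<in> K \<Longrightarrow> norm v < d \<Longrightarrow> p v \<in> S"
    and base: "xbar \<in> S" "p 0 = xbar"
    and deriv: "(p has_derivative (\<lambda>v. v)) (at 0 within K)"
  shows "QDQ_approximating_cone K S xbar"
proof -
  let ?N = "DIM('a)"
  obtain J :: "(nat \<Rightarrow> real) \<Rightarrow> 'a"
    where surj: "J ` RN ?N = UNIV" and norm: "\<And>x. x \<in> RN ?N \<Longrightarrow> norm (J x) = RN_norm ?N x"
      and add: "\<And>x y. J (\<lambda>i. x i + y i) = J x + J y" and scale: "\<And>c x. J (\<lambda>i. c * x i) = c *\<^sub>R J x"
      and cont: "continuous_on UNIV J"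
    by (rule Euclidean_coordinates[where 'a = 'a]) blast
  define \<Gamma> where "\<Gamma> = {x \<in> RN ?N. J x \<in> K}"
  define L where "L = restrict J (RN ?N)"
  have sub: "\<Gamma> \<subseteq> RN ?N" and J\<Gamma>: "J x \<in> K" and LJ: "L x = J x" if "x \<in> \<Gamma>" for x
    using that by (auto simp: \<Gamma>_def L_def)
  have RN: "(\<lambda>i. x i + y i) \<in> RN ?N" "(\<lambda>i. c * x i) \<in> RN ?N" if "x \<in> RN ?N" "y \<in> RN ?N" for x y c
    using that by (simp_all add: topspace_Euclidean_space)
  have "RN_convex_cone ?N \<Gamma>"
    unfolding RN_convex_cone_def \<Gamma>_def
    using K RN by (auto simp: add scale convex_def cone_def)
  moreover have L: "L \<in> Lin ?N"
    unfolding Lin_def L_def using RN by (auto simp: add scale)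
  moreover have "K = L ` \<Gamma>"
  proof -
    have "L ` \<Gamma> = J ` RN ?N \<inter> K"
      using LJ by (auto simp: \<Gamma>_def L_def)
    with surj show ?thesis
      by simp
  qed
  moreover have "is_QDQ ?N (\<lambda>_. S) (\<lambda>_. 0) xbar \<Gamma> {L}"
  proof -
    interpret Lin: Metric_space "Lin ?N :: ((nat \<Rightarrow> real) \<Rightarrow> 'a) set" "Lin_dist ?N"
      by (rule Metric_space_Lin)
    have top: "topspace (Lin_topology ?N) = (Lin ?N :: ((nat \<Rightarrow> real) \<Rightarrow> 'a) set)"
      unfolding Lin_topology_def by (rule Lin.topspace_mtopology)
    have "\<exists>a>0. \<forall>v\<in>K. norm v < a \<longrightarrow> norm (p v - xbar - v) \<le> e * norm v" if "e > 0" for e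
      using deriv that base(2) unfolding has_derivative_within_alt by auto
    then obtain \<rho> a where \<rho>: "modulus \<rho>" "a > 0"
      "\<And>v. v \<in> K \<Longrightarrow> norm v < a \<Longrightarrow> norm (p v - xbar - v) \<le> norm v * \<rho> (norm v)"
      using modulus_of_little_o[of K "\<lambda>v. norm (p v - xbar - v)"] by blast
    define h where "h x = p (J x) - xbar - J x" for x
    have cont_h: "continuous_map (subtopology (Euclidean_space ?N) (RN_ball ?N (\<lambda>_. 0) \<delta> \<inter> \<Gamma>))
             (prod_topology (Lin_topology ?N) euclidean) (\<lambda>\<xi>. (L, h \<xi>))"
      and inclusion: "\<forall>\<xi>\<in>RN_ball ?N (\<lambda>_. 0) \<delta> \<inter> \<Gamma>.
              xbar + L (\<lambda>i. \<xi> i - 0) + h \<xi> \<in> S \<and>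
              (\<exists>L'\<in>{L}. Lin_dist ?N L L' \<le> \<rho> \<delta>) \<and> norm (h \<xi>) \<le> \<delta> * \<rho> \<delta>"
      if \<delta>: "\<delta> \<in> {0..min a d}" for \<delta>
    proof -
      let ?B = "RN_ball ?N (\<lambda>_. 0) \<delta> \<inter> \<Gamma>"
      have B: "norm (J x) < \<delta>" "J x \<in> K" if "x \<in> ?B" for x
        using that norm by (auto simp: RN_ball_def \<Gamma>_def)
      have "continuous_on ?B (\<lambda>x. p (J x))"
        using \<delta> B by (intro continuous_on_compose2[OF p(1)] continuous_on_subset[OF cont]) fastforce+
      then have "continuous_on ?B h"
        unfolding h_def by (intro continuous_intros continuous_on_subset[OF cont]) auto
      moreover have "?B \<subseteq> RN ?N"
        by (auto simp: RN_ball_def)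
      ultimately show "continuous_map (subtopology (Euclidean_space ?N) ?B)
             (prod_topology (Lin_topology ?N) euclidean) (\<lambda>\<xi>. (L, h \<xi>))"
        using L top by (simp add: continuous_map_pairedI subtopology_Euclidean_space_eq_top_of_set)
      show "\<forall>\<xi>\<in>?B. xbar + L (\<lambda>i. \<xi> i - 0) + h \<xi> \<in> S \<and>
              (\<exists>L'\<in>{L}. Lin_dist ?N L L' \<le> \<rho> \<delta>) \<and> norm (h \<xi>) \<le> \<delta> * \<rho> \<delta>"
      proof (intro ballI conjI)
        fix x assume x: "x \<in> ?B"
        show "xbar + L (\<lambda>i. x i - 0) + h x \<in> S"
          using LJ[of x] mem[of "J x"] B[OF x] x \<delta> by (simp add: h_def)
        show "\<exists>L'\<in>{L}. Lin_dist ?N L L' \<le> \<rho> \<delta>"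
          using L \<rho>(1) \<delta> by (simp add: modulus_def)
        have "\<rho> (norm (J x)) \<le> \<rho> \<delta>" "0 \<le> \<rho> (norm (J x))"
          using \<rho>(1) B[OF x] \<delta> by (auto simp: modulus_def intro: mono_onD)
        then have "norm (J x) * \<rho> (norm (J x)) \<le> \<delta> * \<rho> \<delta>"
          using B[OF x] \<delta> by (intro mult_mono) auto
        then show "norm (h x) \<le> \<delta> * \<rho> \<delta>"
          using \<rho>(3)[of "J x"] B[OF x] \<delta> by (simp add: h_def)
      qed
    qed
    have carrier: "compactin (Lin_topology ?N) {L}" "(\<lambda>_. 0) \<in> RN ?N" "\<Gamma> \<subseteq> RN ?N" "0 < min a d"
      using L top \<rho>(2) p(2) by (auto simp: topspace_Euclidean_space \<Gamma>_def)
    show ?thesis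
      unfolding is_QDQ_def
      by (intro conjI exI[of _ \<rho>] exI[of _ "min a d"] ballI carrier \<rho>(1))
        (rule exI[of _ "\<lambda>_. L"], rule exI[of _ h], rule conjI[OF cont_h inclusion])
  qed
  ultimately show ?thesis
    unfolding QDQ_approximating_cone_def using K base(1) by blast
qed


section \<open>The Clarke tangent cone as an approximating cone\<close>

text \<open>A nearest point of \<open>S\<close> to \<open>u\<close> is no further from \<open>u\<close> than \<open>xbar\<close> is, so for \<open>u\<close> close to
  \<open>xbar\<close> it lies in the ball where \<open>S\<close> is contained in \<open>S'\<close>.\<close>

lemma infdist_le_of_locally_subset:
  fixes S S' :: "'a::heine_borel set"
  assumes "closed S" "xbar \<in> S" "S \<inter> ball xbar d \<subseteq> S'" "dist xbar u < d / 2"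
  shows "infdist u S' \<le> infdist u S"
proof -
  obtain q where q: "q \<in> S" "infdist u S = dist u q"
    using infdist_attains_inf[of S u] assms(1,2) by blast
  have "dist u q \<le> dist u xbar"
    using infdist_le[OF assms(2), of u] q(2) by simp
  then have "dist xbar q < d"
    using assms(4) dist_triangle[of xbar q u] by (simp add: dist_commute)
  with q(1) assms(3) have "q \<in> S'"
    by auto
  then show ?thesis
    using infdist_le q(2) by metis
qed

lemma QDQ_approximating_cone_clarke_of_prox_regular:
  fixes S :: "'a::euclidean_space set"
  assumes S: "closed S" "xbar \<in> S" and S': "prox_regular r S'" and "d > 0"
    and eq: "S \<inter> ball xbar d = S' \<inter> ball xbar d"
  shows "QDQ_approximating_cone (clarke_tangent_cone S xbar) S xbar"
proof -
  let ?T = "clarke_tangent_cone S xbar"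
  have r: "r > 0"
    using S' by (simp add: prox_regular_def)
  have xbar: "xbar \<in> S'"
    using eq S(2) \<open>d > 0\<close> by (metis Int_iff centre_in_ball)
  obtain P where P: "\<And>u. P u \<in> S'" "\<And>u. dist u (P u) = infdist u S'"
    and cont: "continuous_on {u. infdist u S' \<le> r / 2} P"
    using prox_regular_continuous_projection[OF S'] by metis
  have near: "infdist (xbar + v) S' \<le> norm v" for v
    using infdist_le[OF xbar, of "xbar + v"] by (simp add: dist_norm)
  \<comment> \<open>\<open>r / 2\<close> keeps \<open>xbar + v\<close> where the projection is continuous; \<open>d / 2\<close> keeps the projected
    point, which is within \<open>2 |v|\<close> of \<open>xbar\<close>, in the ball where the two sets agree.\<close>
  let ?d = "min (r / 2) (d / 2)"
  show ?thesis
  proof (rule QDQ_approximating_coneI[where d = ?d and p = "\<lambda>v. P (xbar + v)"])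
    show "convex ?T" "cone ?T"
      using convex_cone_clarke_tangent_cone[OF S(2)] by auto
    show "xbar \<in> S" "?d > 0"
      using S(2) r \<open>d > 0\<close> by auto
    have "xbar + v \<in> {u. infdist u S' \<le> r / 2}" if "v \<in> ?T \<inter> ball 0 ?d" for v
      using near[of v] that by simp
    then show "continuous_on (?T \<inter> ball 0 ?d) (\<lambda>v. P (xbar + v))"
      by (intro continuous_on_compose2[OF cont] continuous_intros) blast
    show "P (xbar + v) \<in> S" if "norm v < ?d" for v
    proof -
      have "dist xbar (P (xbar + v)) \<le> norm v + dist (xbar + v) (P (xbar + v))"
        using dist_triangle[of xbar "P (xbar + v)" "xbar + v"] by (simp add: dist_norm)
      also have "\<dots> < d"
        using near[of v] P(2)[of "xbar + v"] that by simp
      finally have "P (xbar + v) \<in> S' \<inter> ball xbar d"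
        using P(1) by simp
      then show ?thesis
        unfolding eq[symmetric] by simp
    qed
    show P0: "P (xbar + 0) = xbar"
      using P(2)[of xbar] xbar by simp
    show "((\<lambda>v. P (xbar + v)) has_derivative (\<lambda>v. v)) (at 0 within ?T)"
      unfolding has_derivative_within_alt
    proof (intro conjI allI impI bounded_linear_ident)
      fix e :: real assume "e > 0"
      then obtain c where c: "c > 0" "\<And>v. v \<in> ?T \<Longrightarrow> norm v < c \<Longrightarrow> infdist (xbar + v) S \<le> e * norm v"
        using infdist_clarke_tangent_cone_little_o[OF S(2)] by metis
      have "norm (P (xbar + v) - P (xbar + 0) - (v - 0)) \<le> e * norm (v - 0)"
        if v: "v \<in> ?T" "norm (v - 0) < min c (d / 2)" for v
      proof -
        have "norm (P (xbar + v) - P (xbar + 0) - (v - 0)) = infdist (xbar + v) S'"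
          unfolding P0 P(2)[symmetric] dist_norm
          by (metis (no_types, opaque_lifting) diff_diff_eq diff_zero norm_minus_commute)
        also have "\<dots> \<le> infdist (xbar + v) S"
          by (rule infdist_le_of_locally_subset[OF S, of d]) (use v(2) eq in \<open>simp_all add: dist_norm\<close>)
        also have "\<dots> \<le> e * norm (v - 0)"
          using c(2)[OF v(1)] v(2) by simp
        finally show ?thesis .
      qed
      then show "\<exists>c>0. \<forall>v\<in>?T. norm (v - 0) < c \<longrightarrow>
          norm (P (xbar + v) - P (xbar + 0) - (v - 0)) \<le> e * norm (v - 0)"
        using c(1) \<open>d > 0\<close> by (intro exI[of _ "min c (d / 2)"]) auto
    qed
  qed
qed

lemma QDQ_approximating_cone_of_locally_subset:
  fixes S K :: "'a::euclidean_space set"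
  assumes "convex K" "cone K" "xbar \<in> S" "d > 0" "(\<lambda>v. xbar + v) ` K \<inter> ball xbar d \<subseteq> S"
  shows "QDQ_approximating_cone K S xbar"
proof (rule QDQ_approximating_coneI[where d = d and p = "\<lambda>v. xbar + v"])
  show "xbar + v \<in> S" if "v \<in> K" "norm v < d" for v
    using assms(5) that by (auto simp: dist_norm image_subset_iff subset_iff)
qed (use assms in \<open>auto intro!: continuous_intros derivative_eq_intros\<close>)

theorem theorem3p1:
  fixes S :: "(real ^ 'n) set" and xbar :: "real ^ 'n"
  assumes "S \<noteq> {}" and "closed S" and "xbar \<in> S"
    and "quasi_prox_regular S xbar"
  shows "QDQ_approximating_cone (clarke_tangent_cone S xbar) S xbar"
proof -
  obtain \<delta> where "\<delta> > 0" and
    "(\<lambda>v. xbar + v) ` clarke_tangent_cone S xbar \<inter> ball xbar \<delta> \<subseteq> S \<or>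
     (\<exists>r>0. \<exists>S'. prox_regular r S' \<and> S \<inter> ball xbar \<delta> = S' \<inter> ball xbar \<delta>)"
    using assms(4) unfolding quasi_prox_regular_def by blast
  then consider "(\<lambda>v. xbar + v) ` clarke_tangent_cone S xbar \<inter> ball xbar \<delta> \<subseteq> S"
    | r S' where "prox_regular r S'" "S \<inter> ball xbar \<delta> = S' \<inter> ball xbar \<delta>"
    by blast
  then show ?thesis
  proof cases
    case 1
    then show ?thesis
      by (rule QDQ_approximating_cone_of_locally_subset
          [OF convex_cone_clarke_tangent_cone[OF assms(3)] assms(3) \<open>\<delta> > 0\<close>])
  next
    case 2
    then show ?thesis
      by (rule QDQ_approximating_cone_clarke_of_prox_regular[OF assms(2,3) _ \<open>\<delta> > 0\<close>])
  qed
qed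

end
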